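(* Let $\boldsymbol x\in\{0,1\}^\omega$ begin with $010$. Then $\boldsymbol x$ is faux-bonacci if and only if $\boldsymbol x=010\bullet\boldsymbol f$ for some $\boldsymbol f\in V$, where $V=\mathcal O^\omega-\mathcal O^*F\mathcal O^\omega$ and $$F=\alpha^*\beta(\alpha\alpha+\alpha\beta+\beta\alpha\alpha+\beta\beta\beta^*\alpha\alpha)^*(\beta\alpha\beta+\beta\beta\beta^*\alpha\beta)$$ (a regular expression over the alphabet $\mathcal O=\{\alpha,\beta\}$), i.e. $V$ is the set of $\omega$-words over $\mathcal O$ having no factor in $F$.
   Context: Words are over $\{0,1\}$ unless stated otherwise. $\varphi$ is the morphism $0\mapsto 01$, $1\mapsto 0$. For non-empty $X$, $X^-$ is $X$ with last letter erased; a $4^-$-power is $XXXX^-$ with $X$ non-empty; a binary word is faux-bonacci if it has no factor $11$ and no factor that is a $4^-$-power. The finite Fibonacci words are $F_0=0$, $F_1=01$, $F_{n+2}=F_{n+1}F_n$. The Parikh vector of a binary word $w$ is $\pi(w)=[|w|_0,|w|_1]$, with vectors compared componentwise. For $n\ge 1$ and a word $w=yF_n$ with $\pi(y)\le\pi(F_n)-\pi(0)$, define $\alpha(w)=yF_{n+1}$ and $\beta(w)=yF_{n-1}F_{n+1}$; the results again have this form with $n$ replaced by $n+1$, and $w$ is a prefix of both. Let $\mathcal O=\{\alpha,\beta\}$. For a word $w=yF_2$ with $\pi(y)\le\pi(F_2)-\pi(0)$, define $w\bullet\epsilon=w$ and $w\bullet(f\gamma)=(w\bullet f)\bullet\gamma$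 for $f\in\mathcal O^*$, $\gamma\in\mathcal O$, where, if $f$ has length $k$, $w\bullet f$ has the form $y'F_{k+2}$ with $\pi(y')\le\pi(F_{k+2})-\pi(0)$ and $\gamma$ is applied with index $n=k+2$. For $\boldsymbol f=f_1f_2\cdots\in\mathcal O^\omega$, $w\bullet\boldsymbol f=\lim_{n\to\infty} w\bullet(f_1\cdots f_n)$ (each term is a prefix of the next). $\mathcal O^*F\mathcal O^\omega$ denotes the set of $\omega$-words over $\mathcal O$ having a factor in the language $F$. *)

theory Defs
  imports
    "HOL-Library.Product_Order"
    "HOL-Library.Product_Plus"
    "HOL-Library.Sublist"
    "HOL-Library.Omega_Words_Fun"
begin

(* Finite words are lists; omega-words are 'a word = nat => 'a.  Since Omega_Words_Fun is
   imported last, unqualified "prefix n x" is the prefix of length n of the omega-word x,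
   while the prefix order on finite words is Sublist.prefix. *)

datatype letter = L0 | L1

section \<open>Faux-bonacci words\<close>

definition factor :: "'a list \<Rightarrow> 'a word \<Rightarrow> bool" where
  "factor u x \<longleftrightarrow> (\<exists>v z. x = v \<frown> u \<frown> z)"

definition four_minus_power :: "'a list \<Rightarrow> bool" where
  "four_minus_power w \<longleftrightarrow> (\<exists>X. X \<noteq> [] \<and> w = X @ X @ X @ butlast X)"

definition faux_bonacci :: "letter word \<Rightarrow> bool" where
  "faux_bonacci x \<longleftrightarrow>
     \<not> factor [L1, L1] x \<and> (\<forall>w. factor w x \<longrightarrow> \<not> four_minus_power w)"

section \<open>The operators and their action\<close>

fun fibw :: "nat \<Rightarrow> letter list" where
  "fibw 0 = [L0]"
| "fibw (Suc 0) = [L0, L1]"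
| "fibw (Suc (Suc n)) = fibw (Suc n) @ fibw n"

definition parikh :: "letter list \<Rightarrow> nat \<times> nat" where
  "parikh w = (count_list w L0, count_list w L1)"

(* Every Fibonacci word contains the letter 0, so the subtraction never truncates. *)
definition bounded_by_fib :: "nat \<Rightarrow> letter list \<Rightarrow> bool" where
  "bounded_by_fib n y \<longleftrightarrow> parikh y \<le> parikh (fibw n) - parikh [L0]"

(* The index n is an argument, since the decomposition w = y F_n depends on it.
   Both operators are specified only on words of the form y F_n with y bounded; the case n = 0
   is never used. *)
definition alpha :: "nat \<Rightarrow> letter list \<Rightarrow> letter list" where
  "alpha n w = (THE w'. \<exists>y. w = y @ fibw n \<and> bounded_by_fib n y \<and> w' = y @ fibw (n + 1))"

definition beta :: "nat \<Rightarrow> letter list \<Rightarrow> letter list" where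
  "beta n w = (THE w'. \<exists>y. w = y @ fibw n \<and> bounded_by_fib n y \<and>
                              w' = y @ fibw (n - 1) @ fibw (n + 1))"

datatype oper = \<alpha> | \<beta>

fun act :: "nat \<Rightarrow> oper \<Rightarrow> letter list \<Rightarrow> letter list" where
  "act n \<alpha> w = alpha n w"
| "act n \<beta> w = beta n w"

(* The last operator of f acts with index |f| - 1 + 2 = |f| + 1; see bullet_snoc. *)
function bullet :: "letter list \<Rightarrow> oper list \<Rightarrow> letter list" (infixl \<open>\<bullet>\<close> 70) where
  "w \<bullet> f = (if f = [] then w else act (length f + 1) (last f) (w \<bullet> butlast f))"
  by auto
termination
  by (relation "measure (\<lambda>(w, f). length f)") auto

declare bullet.simps [simp del]

lemma bullet_Nil [simp]: "w \<bullet> [] = w"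
  by (simp add: bullet.simps)

lemma bullet_snoc [simp]: "w \<bullet> (f @ [\<gamma>]) = act (length f + 2) \<gamma> (w \<bullet> f)"
  by (subst bullet.simps) simp

(* Letterwise limit of a sequence of finite words. *)
definition word_limit :: "(nat \<Rightarrow> 'a list) \<Rightarrow> 'a word \<Rightarrow> bool" where
  "word_limit u x \<longleftrightarrow> (\<forall>i. \<forall>\<^sub>F n in sequentially. i < length (u n) \<and> u n ! i = x i)"

definition bullet_omega :: "letter list \<Rightarrow> oper word \<Rightarrow> letter word"
    (infixl \<open>\<bullet>\<^sub>\<omega>\<close> 70) where
  "w \<bullet>\<^sub>\<omega> f = (THE x. word_limit (\<lambda>n. w \<bullet> prefix n f) x)"

section \<open>Well-definedness of the action\<close>

lemma alpha_eq: "bounded_by_fib n y \<Longrightarrow> alpha n (y @ fibw n) = y @ fibw (n + 1)"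
  by (simp add: alpha_def)

lemma beta_eq:
  "bounded_by_fib n y \<Longrightarrow> beta n (y @ fibw n) = y @ fibw (n - 1) @ fibw (n + 1)"
  by (simp add: beta_def)

lemma fibw_rec: "n \<ge> 1 \<Longrightarrow> fibw (n + 1) = fibw n @ fibw (n - 1)"
  by (cases n) auto

lemma count_fibw_L0: "count_list (fibw n) L0 \<ge> 1"
  by (induction n rule: fibw.induct) auto

lemma fibw_prefix: "Sublist.prefix (fibw n) (fibw (n + 1))"
  by (cases n) auto

lemma length_fibw: "length (fibw n) > n"
proof (induction n rule: fibw.induct)
  case (3 n)
  then show ?case by (cases "fibw n") auto
qed auto

definition has_form :: "nat \<Rightarrow> letter list \<Rightarrow> bool" where
  "has_form n w \<longleftrightarrow> (\<exists>y. w = y @ fibw n \<and> bounded_by_fib n y)"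

lemma act_has_form:
  assumes "n \<ge> 1" "has_form n w"
  shows "has_form (n + 1) (act n \<gamma> w)"
proof -
  obtain y where w: "w = y @ fibw n" and y: "bounded_by_fib n y"
    using assms(2) by (auto simp: has_form_def)
  have 1: "bounded_by_fib (n + 1) y" "bounded_by_fib (n + 1) (y @ fibw (n - 1))"
    using y fibw_rec[OF assms(1)] count_fibw_L0[of n]
    by (auto simp: bounded_by_fib_def parikh_def)
  show ?thesis
  proof (cases \<gamma>)
    case \<alpha>
    then have "act n \<gamma> w = y @ fibw (n + 1)"
      using y w by (simp add: alpha_eq)
    then show ?thesis using 1 unfolding has_form_def by (intro exI[of _ y] conjI)
  next
    case \<beta>
    then have "act n \<gamma> w = (y @ fibw (n - 1)) @ fibw (n + 1)"
      using y w by (simp add: beta_eq)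
    then show ?thesis using 1 unfolding has_form_def
      by (intro exI[of _ "y @ fibw (n - 1)"] conjI)
  qed
qed

(* For n = 1 this fails for the second operator: F_1 = 01 is not a prefix of F_0 F_2 = 0010. *)
lemma act_prefix:
  assumes "n \<ge> 2" "has_form n w"
  shows "Sublist.prefix w (act n \<gamma> w)"
proof -
  obtain y where w: "w = y @ fibw n" and y: "bounded_by_fib n y"
    using assms(2) by (auto simp: has_form_def)
  obtain m where n: "n = Suc (Suc m)"
    using assms(1) by (metis Suc_le_D numeral_2_eq_2 Suc_le_mono)
  show ?thesis
  proof (cases \<gamma>)
    case \<alpha>
    then show ?thesis using y w fibw_rec[of n] assms(1) by (simp add: alpha_eq)
  next
    case \<beta>
    have "Sublist.prefix (fibw n) (fibw (n - 1) @ fibw (n + 1))"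
      using fibw_prefix[of m] by (auto simp: n Sublist.prefix_def)
    with \<beta> show ?thesis using y w by (simp add: beta_eq)
  qed
qed

lemma has_form_010: "has_form 2 [L0, L1, L0]"
  by (auto simp: has_form_def bounded_by_fib_def parikh_def numeral_2_eq_2)

lemma bullet_has_form: "has_form 2 w \<Longrightarrow> has_form (length f + 2) (w \<bullet> f)"
proof (induction f rule: rev_induct)
  case (snoc \<gamma> f)
  then show ?case using act_has_form[of "length f + 2" "w \<bullet> f" \<gamma>] by simp
qed (simp add: numeral_2_eq_2)

lemma bullet_prefix_step:
  assumes "has_form 2 w"
  shows "Sublist.prefix (w \<bullet> prefix n f) (w \<bullet> prefix (Suc n) f)"
proof -
  have "prefix (Suc n) f = prefix n f @ [f n]"
    by (simp add: subsequence_def)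
  then show ?thesis
    using act_prefix[of "n + 2" "w \<bullet> prefix n f" "f n"] bullet_has_form[OF assms, of "prefix n f"]
    by simp
qed

lemma bullet_prefix_mono:
  assumes "has_form 2 w" "m \<le> n"
  shows "Sublist.prefix (w \<bullet> prefix m f) (w \<bullet> prefix n f)"
  using assms(2)
proof (induction n rule: dec_induct)
  case (step n)
  then show ?case
    using bullet_prefix_step[OF assms(1)] prefix_order.trans by blast
qed simp

lemma length_bullet: "has_form 2 w \<Longrightarrow> n < length (w \<bullet> prefix n f)"
  using bullet_has_form[of w "prefix n f"] length_fibw[of "n + 2"]
  by (auto simp: has_form_def)

lemma word_limit_unique: "word_limit u x \<Longrightarrow> word_limit u x' \<Longrightarrow> x = x'"
proof
  fix i
  assume "word_limit u x" "word_limit u x'"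
  then have "\<forall>\<^sub>F n in sequentially. i < length (u n) \<and> u n ! i = x i"
    and "\<forall>\<^sub>F n in sequentially. i < length (u n) \<and> u n ! i = x' i"
    by (simp_all add: word_limit_def)
  then have "\<forall>\<^sub>F n in sequentially. x i = x' i"
    by eventually_elim simp
  then show "x i = x' i"
    by simp
qed

lemma word_limit_bullet_omega:
  assumes "has_form 2 w"
  shows "word_limit (\<lambda>n. w \<bullet> prefix n f) (w \<bullet>\<^sub>\<omega> f)"
proof -
  have lim: "word_limit (\<lambda>n. w \<bullet> prefix n f) (\<lambda>i. (w \<bullet> prefix i f) ! i)"
    unfolding word_limit_def
  proof (intro allI eventually_sequentiallyI)
    fix i n :: nat
    assume "i \<le> n"
    then show "i < length (w \<bullet> prefix n f) \<and> (w \<bullet> prefix n f) ! i = (w \<bullet> prefix i f) ! i"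
      using bullet_prefix_mono[OF assms, of i n f] length_bullet[OF assms, of i f]
      by (auto simp: Sublist.prefix_def nth_append)
  qed
  then have "w \<bullet>\<^sub>\<omega> f = (\<lambda>i. (w \<bullet> prefix i f) ! i)"
    unfolding bullet_omega_def by (intro the_equality) (auto intro: word_limit_unique)
  with lim show ?thesis by simp
qed

section \<open>The language of forbidden factors\<close>

definition lconc :: "'a list set \<Rightarrow> 'a list set \<Rightarrow> 'a list set" (infixr \<open>\<cdot>\<close> 75) where
  "A \<cdot> B = {u @ v | u v. u \<in> A \<and> v \<in> B}"

definition lstar :: "'a list set \<Rightarrow> 'a list set" where
  "lstar A = concat ` lists A"

definition F_lang :: "oper list set" where
  "F_lang =
     lstar {[\<alpha>]} \<cdot> {[\<beta>]}
     \<cdot> lstar ({[\<alpha>, \<alpha>]} \<union> {[\<alpha>, \<beta>]} \<union> {[\<beta>, \<alpha>, \<alpha>]}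
               \<union> {[\<beta>, \<beta>]} \<cdot> lstar {[\<beta>]} \<cdot> {[\<alpha>, \<alpha>]})
     \<cdot> ({[\<beta>, \<alpha>, \<beta>]} \<union> {[\<beta>, \<beta>]} \<cdot> lstar {[\<beta>]} \<cdot> {[\<alpha>, \<beta>]})"

definition V :: "oper word set" where
  "V = UNIV - {g \<frown> u \<frown> h | g u h. u \<in> F_lang}"

end

(* Write A(f) for the word generated from 010 by f, and phi for the Fibonacci morphism. Then
   A(\<alpha> f) = phi(A(f)) and A(\<beta> f) = phi(0 A(f)), and a word y without 11 contains a 4^- power iff
   phi(y) does; passing from phi(y) to y shortens the period. Every faux-bonacci word starting
   with 010 is phi(y) or phi(0 y) for such a word y again, which yields the operator word f.
   Whether A(f) is faux-bonacci then depends on the left extensions 0 A(f), 1 A(f), 10 A(f), 010 A(f)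
   and 01 A(f): peeling operators off f moves between them like the states of a finite automaton,
   and the only way to fail is 01 A(\<beta> f) = 0101010..., which is the exit of the language F. *)
theory Submission
  imports Defs
begin

section \<open>The Fibonacci morphism\<close>

text \<open>The operators change the right end of a word, with an index that grows along the
  operator word, whereas desubstitution works from the left. The recursion for A(\<gamma> f) is
  therefore obtained on finite words: phi sends F_n to F_{n+1}, so it raises every index by one and
  commutes with the later operators. The delicate point is an extension such as 1 A(\<alpha> f) = 1
  phi(A(f)), where the added 1 is only the second half of a block 01. A power that starts at this 1
  is not aligned with blocks. Going up, the absence of 11 and 000 guarantees that the image of a
  power can afford to lose its first 0. Going down, either a further 0 completes the block, or the
  beginning 101010 forces a smaller power further to the right. Descent on the period excludes
  operator words that could be peeled forever without reaching an exit.\<close>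

fun fib_letter :: "letter \<Rightarrow> letter list" where
  "fib_letter L0 = [L0, L1]"
| "fib_letter L1 = [L0]"

lemma fib_letter_neq_Nil [simp]: "fib_letter a \<noteq> []"
  by (cases a) auto

abbreviation fib_list :: "letter list \<Rightarrow> letter list" where
  "fib_list u \<equiv> concat (map fib_letter u)"

(* No image of a letter is empty, so i + 1 letters of x determine letter i of the image. *)
definition fib_word :: "letter word \<Rightarrow> letter word" where
  "fib_word x = (\<lambda>i. fib_list (prefix (Suc i) x) ! i)"

lemma length_fib_list: "length u \<le> length (fib_list u)"
proof (induction u)
  case (Cons a u)
  then show ?case by (cases a) auto
qed simp

lemma prefix_Suc_build: "prefix (Suc i) (a ## x) = a # prefix i x"
  by (rule nth_equalityI) (auto simp: nth_Cons split: nat.split simp del: subseq_to_Suc)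

lemma fib_list_prefix_nth:
  assumes "i < length (fib_list (prefix m x))" "m \<le> n"
  shows "fib_list (prefix n x) ! i = fib_list (prefix m x) ! i"
proof -
  have "prefix n x = prefix m x @ subsequence x m n"
    using subsequence_append[where i = m and j = "n - m" and w = x] assms(2) by simp
  then show ?thesis using assms(1) by (simp add: nth_append)
qed

lemma fib_word_build [simp]:
  "fib_word (L0 ## x) = L0 ## L1 ## fib_word x"
  "fib_word (L1 ## x) = L0 ## fib_word x"
proof -
  have len: "i < length (fib_list (prefix (Suc i) x))" for i
    using length_fib_list[of "prefix (Suc i) x"] by simp
  show "fib_word (L0 ## x) = L0 ## L1 ## fib_word x"
  proof
    fix i
    consider "i = 0" | "i = 1" | j where "i = Suc (Suc j)"
      by (metis One_nat_def old.nat.exhaust)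
    then show "fib_word (L0 ## x) i = (L0 ## L1 ## fib_word x) i"
    proof cases
      case 3
      then show ?thesis
        using fib_list_prefix_nth[OF len[of j], of "Suc (Suc j)"]
        by (simp add: fib_word_def prefix_Suc_build del: subseq_to_Suc)
    qed (simp_all add: fib_word_def prefix_Suc_build del: subseq_to_Suc)
  qed
  show "fib_word (L1 ## x) = L0 ## fib_word x"
  proof
    fix i
    show "fib_word (L1 ## x) i = (L0 ## fib_word x) i"
      by (cases i) (simp_all add: fib_word_def prefix_Suc_build del: subseq_to_Suc)
  qed
qed

lemma fib_word_conc [simp]: "fib_word (u \<frown> x) = fib_list u \<frown> fib_word x"
proof (induction u)
  case (Cons a u)
  then show ?case by (cases a) auto
qed simp

lemma word_cases: obtains a y where "x = a ## y"
  by (metis build_first)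

lemma fib_word_0 [simp]: "fib_word x 0 = L0"
  by (cases x rule: word_cases; cases "x 0") (auto elim: letter.exhaust)

lemma fib_list_hd: "fib_list u \<noteq> L1 # v"
  by (cases u; cases "hd u") auto

text \<open>Both letter images start with 0. If the first letters differed, then after this common 0
  one side would continue with 1 and the other with an image, which never starts with 1.\<close>

lemma fib_list_inject: "fib_list u = fib_list v \<Longrightarrow> u = v"
proof (induction u arbitrary: v)
  case (Cons a u)
  then obtain b v' where v: "v = b # v'"
    by (cases v) auto
  show ?case
    using Cons fib_list_hd[of u] fib_list_hd[of v'] fib_list_hd[of u, symmetric]
      fib_list_hd[of v', symmetric]
    by (cases a; cases b) (auto simp: v)
qed simp

section \<open>Desubstitution\<close>

text \<open>In an image the letter 1 occurs only as the second half of a block 01, so the letter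
  after a cut tells whether the cut lies between blocks or inside one. The induction is on length
  because a block 01 takes two letters off \<open>v\<close>.\<close>

lemma fib_word_split:
  assumes "fib_word y = v \<frown> w"
  shows "(w 0 = L0 \<and> (\<exists>a b. y = a \<frown> b \<and> v = fib_list a \<and> w = fib_word b)) \<or>
    (w 0 = L1 \<and> (\<exists>a b. y = a \<frown> L0 ## b \<and> v = fib_list a @ [L0] \<and> w = L1 ## fib_word b))"
  using assms
proof (induction v arbitrary: y rule: length_induct)
  case (1 v)
  obtain c y' where y: "y = c ## y'" by (rule word_cases)
  show ?case
  proof (cases v)
    case Nil
    then show ?thesis using "1.prems"
      by (metis conc_empty concat.simps(1) fib_word_0 list.simps(8))
  next
    case (Cons d v')
    note v = this
    show ?thesis
    proof (cases c)
      case L1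
      then have "d = L0" and eq: "fib_word y' = v' \<frown> w"
        using "1.prems" by (auto simp: y v)
      from 1(1)[rule_format, OF _ eq] v
      consider a b where "w 0 = L0" "y' = a \<frown> b" "v' = fib_list a" "w = fib_word b"
        | a b where "w 0 = L1" "y' = a \<frown> L0 ## b" "v' = fib_list a @ [L0]" "w = L1 ## fib_word b"
        by auto
      then show ?thesis
      proof cases
        case 1
        then show ?thesis using v y L1 \<open>d = L0\<close>
          by (intro disjI1 conjI exI[of _ "L1 # a"] exI[of _ b]) auto
      next
        case 2
        then show ?thesis using v y L1 \<open>d = L0\<close>
          by (intro disjI2 conjI exI[of _ "L1 # a"] exI[of _ b]) auto
      qed
    next
      case L0
      then have d: "d = L0" and eq: "L1 ## fib_word y' = v' \<frown> w"
        using "1.prems" by (auto simp: y v)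
      show ?thesis
      proof (cases v')
        case Nil
        then show ?thesis using eq v y L0 d
          by (intro disjI2 conjI exI[of _ "[]"] exI[of _ y']) auto
      next
        case (Cons e v'')
        then have "e = L1" and eq: "fib_word y' = v'' \<frown> w"
          using eq by auto
        from 1(1)[rule_format, OF _ eq] v Cons
        consider a b where "w 0 = L0" "y' = a \<frown> b" "v'' = fib_list a" "w = fib_word b"
          | a b where "w 0 = L1" "y' = a \<frown> L0 ## b" "v'' = fib_list a @ [L0]" "w = L1 ## fib_word b"
          by auto
        then show ?thesis
        proof cases
          case 1
          then show ?thesis using v y L0 d Cons \<open>e = L1\<close>
            by (intro disjI1 conjI exI[of _ "L0 # a"] exI[of _ b]) auto
        next
          case 2
          then show ?thesis using v y L0 d Cons \<open>e = L1\<close>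
            by (intro disjI2 conjI exI[of _ "L0 # a"] exI[of _ b]) auto
        qed
      qed
    qed
  qed
qed

lemma fib_word_split_L0:
  assumes "fib_word y = v \<frown> w" "w 0 = L0"
  obtains a b where "y = a \<frown> b" "v = fib_list a" "w = fib_word b"
  using fib_word_split[OF assms(1)] assms(2) by auto

lemma fib_word_split_fib_list:
  assumes "fib_word y = fib_list u \<frown> w" "w 0 = L0"
  obtains b where "y = u \<frown> b" "w = fib_word b"
  using fib_word_split_L0[OF assms] fib_list_inject by metis

lemma no_11_fib_word: "\<not> factor [L1, L1] (fib_word y)"
proof
  assume "factor [L1, L1] (fib_word y)"
  then obtain v w where "fib_word y = v \<frown> L1 ## L1 ## w"
    by (auto simp: factor_def)
  from fib_word_split[OF this] obtain b where "L1 ## w = fib_word b" by auto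
  then show False by (metis build.simps(1) fib_word_0 letter.distinct(1))
qed

lemma factor_conc: "factor u y \<Longrightarrow> factor u (v \<frown> y)"
  unfolding factor_def by (metis conc_conc)

lemma factor_build: "factor u y \<Longrightarrow> factor u (a ## y)"
  using factor_conc[of u y "[a]"] by simp

lemma factorI: "x = v \<frown> u \<frown> w \<Longrightarrow> factor u x"
  unfolding factor_def by blast

text \<open>A 0 followed by another 0 is a whole block, hence the image of 1; the first two letters
  of 000 thus come from 11.\<close>

lemma no_000_fib_word:
  assumes "\<not> factor [L1, L1] y"
  shows "\<not> factor [L0, L0, L0] (fib_word y)"
proof
  assume "factor [L0, L0, L0] (fib_word y)"
  then obtain v w where "fib_word y = v \<frown> L0 ## L0 ## L0 ## w"
    by (auto simp: factor_def)
  then obtain a b where y: "y = a \<frown> b" and b: "L0 ## L0 ## L0 ## w = fib_word b"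
    by (rule fib_word_split_L0) auto
  obtain c d b' where "b = c ## d ## b'" by (metis word_cases)
  with b have "b = L1 ## L1 ## b'"
    by (cases c; cases d) (auto dest: arg_cong[of _ _ "\<lambda>x. x 0"])
  with y assms show False
    using factorI[of y a "[L1, L1]" b'] by simp
qed

text \<open>The letter after a leading 0 decides whether the first block is 01 or 0, and the absence
  of 11 makes the remainder start with 0 again. Dependent choice collects the remainders.\<close>

lemma desubstitution:
  assumes "x 0 = L0" "\<not> factor [L1, L1] x"
  obtains y where "x = fib_word y"
proof -
  let ?P = "\<lambda>n s. s 0 = L0 \<and> \<not> factor [L1, L1] s"
  let ?Q = "\<lambda>n s s'. \<exists>a. s = fib_letter a \<frown> s'"
  have "\<exists>s. \<forall>n. ?P n (s n) \<and> s 0 = x \<and> ?Q n (s n) (s (Suc n))"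
  proof -
    have "\<exists>s. \<forall>n. (?P n (s n) \<and> (n = 0 \<longrightarrow> s n = x)) \<and> ?Q n (s n) (s (Suc n))"
    proof (rule dependent_nat_choice)
      show "\<exists>s. ?P 0 s \<and> (0 = (0::nat) \<longrightarrow> s = x)" using assms by auto
    next
      fix s :: "letter word" and n :: nat
      assume s: "?P n s \<and> (n = 0 \<longrightarrow> s = x)"
      obtain a b s' where s': "s = a ## b ## s'" by (metis word_cases)
      have a: "a = L0" using s s' by simp
      show "\<exists>y. (?P (Suc n) y \<and> (Suc n = 0 \<longrightarrow> y = x)) \<and> ?Q n s y"
      proof (cases b)
        case L0
        have "\<not> factor [L1, L1] (b ## s')" using s s' factor_build by metis
        with a L0 s' show ?thesis
          by (intro exI[of _ "b ## s'"] conjI exI[of _ L1]) auto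
      next
        case L1
        have "\<not> factor [L1, L1] s'" using s s' factor_build by metis
        moreover have "s' 0 = L0"
        proof (rule ccontr)
          assume "s' 0 \<noteq> L0"
          then have "s' = L1 ## suffix 1 s'" by (metis One_nat_def build_first letter.exhaust)
          then have "s = [a] \<frown> [L1, L1] \<frown> suffix 1 s'" using s' L1 by simp
          then show False using s factorI by blast
        qed
        ultimately show ?thesis using a L1 s'
          by (intro exI[of _ "s'"] conjI exI[of _ L0]) auto
      qed
    qed
    then show ?thesis by blast
  qed
  then obtain s where s0: "s 0 = x" and "\<forall>n. ?Q n (s n) (s (Suc n))" by blast
  then obtain y where y: "\<And>n. s n = fib_letter (y n) \<frown> s (Suc n)" by metis
  have x: "x = fib_list (prefix n y) \<frown> s n" for n
  proof (induction n)
    case (Suc n)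
    then show ?case using y[of n] by simp
  qed (simp add: s0)
  have "x i = fib_word y i" for i
    using length_fib_list[of "prefix (Suc i) y"] x[of "Suc i"]
    by (metis (no_types, lifting) Suc_le_lessD conc_fst diff_zero fib_word_def subsequence_length)
  then show ?thesis using that by blast
qed

section \<open>Powers of exponent just below four\<close>

text \<open>The period is a parameter because it is the measure that descent through phi
  decreases.\<close>

definition has_4m_power :: "nat \<Rightarrow> letter word \<Rightarrow> bool" where
  "has_4m_power n x \<longleftrightarrow>
     (\<exists>v X w. X \<noteq> [] \<and> length X = n \<and> x = v \<frown> (X @ X @ X @ butlast X) \<frown> w)"

lemma has_4m_powerI:
  "x = v \<frown> (X @ X @ X @ butlast X) \<frown> w \<Longrightarrow> X \<noteq> [] \<Longrightarrow> has_4m_power (length X) x"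
  unfolding has_4m_power_def by blast

lemma faux_bonacci_iff:
  "faux_bonacci x \<longleftrightarrow> \<not> factor [L1, L1] x \<and> (\<forall>n. \<not> has_4m_power n x)"
  unfolding faux_bonacci_def four_minus_power_def has_4m_power_def factor_def by blast

lemma has_4m_power_conc: "has_4m_power n x \<Longrightarrow> has_4m_power n (v \<frown> x)"
  unfolding has_4m_power_def by (metis conc_conc)

lemma has_4m_power_build: "has_4m_power n x \<Longrightarrow> has_4m_power n (a ## x)"
  using has_4m_power_conc[of n x "[a]"] by simp

lemma fourth_power_conc:
  "X \<noteq> [] \<Longrightarrow> (X @ X @ X @ X) \<frown> w = (X @ X @ X @ butlast X) \<frown> [last X] \<frown> w"
  using append_butlast_last_id[of X] by (metis append_assoc conc_conc)

(* A 4-power starting with 0 arises from a power starting with 1 by moving it one letter left. *)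
lemma has_4m_power_fib_word_L0:
  assumes "has_4m_power n (fib_word y)"
  obtains v X w where "length X = n" "X \<noteq> []" "hd X = L0"
    "fib_word y = v \<frown> (X @ X @ X @ butlast X) \<frown> w"
proof -
  obtain v X w where X: "length X = n" "X \<noteq> []"
    "fib_word y = v \<frown> (X @ X @ X @ butlast X) \<frown> w"
    using assms unfolding has_4m_power_def by blast
  show ?thesis
  proof (cases "hd X")
    case L0
    then show ?thesis using X that by blast
  next
    case L1
    then obtain Z where Z: "X = L1 # Z" using X by (cases X) auto
    have no: "\<And>p q. fib_word y \<noteq> p \<frown> [L1, L1] \<frown> q"
      using no_11_fib_word unfolding factor_def by blast
    have "v \<noteq> []"
    proof
      assume "v = []"
      then have "fib_word y 0 = L1" using X Z by simp
      then show False by simp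
    qed
    then obtain v' c where v: "v = v' @ [c]" by (metis append_butlast_last_id)
    have "c = L0"
      using no[of v' "(Z @ X @ X @ butlast X) \<frown> w"] X Z v by (cases c) auto
    have "Z \<noteq> []" using no[of v "L1 ## w"] X Z by auto
    then obtain Z' d where Z': "Z = Z' @ [d]" by (metis append_butlast_last_id)
    have "d = L0"
      using no[of "v @ L1 # Z'" "(Z @ X @ butlast X) \<frown> w"] X Z Z' by (cases d) auto
    \<comment> \<open>\<open>X\<close> is 1 Z' 0 and a 0 precedes it. Moving its last 0 to the front
      gives a conjugate, and the 0 gained on the left completes a full fourth power.\<close>
    let ?X = "L0 # L1 # Z'"
    have "fib_word y = v' \<frown> (?X @ ?X @ ?X @ ?X) \<frown> w"
      using X v \<open>c = L0\<close> \<open>d = L0\<close> Z Z' by simp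
    then show ?thesis
      using X Z Z' fourth_power_conc[of ?X w] by (intro that[of ?X v' "[last ?X] \<frown> w"]) simp_all
  qed
qed

lemma length_less_fib_list: "L0 \<in> set u \<Longrightarrow> length u < length (fib_list u)"
proof (induction u)
  case (Cons a u)
  then show ?case using length_fib_list[of u] by (cases a) auto
qed simp

text \<open>A period word starting with 0 is cut at block boundaries only, so it is phi(Y) and the
  three full copies desubstitute. The letter missing from the fourth copy belongs to the block of
  the last letter of Y, so the rest of Y can still be recovered.\<close>

lemma has_4m_power_fib_wordD:
  assumes no11: "\<not> factor [L1, L1] y" and "has_4m_power n (fib_word y)"
  shows "\<exists>m<n. has_4m_power m y"
proof -
  obtain v X w where X: "length X = n" "X \<noteq> []" "hd X = L0"
    and eq: "fib_word y = v \<frown> (X @ X @ X @ butlast X) \<frown> w"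
    using has_4m_power_fib_word_L0[OF assms(2)] by blast
  have hd: "(X \<frown> z) 0 = L0" for z using X by (cases X) auto
  have "fib_word y = v \<frown> X \<frown> X \<frown> X \<frown> butlast X \<frown> w"
    using eq by simp
  then obtain a b where y: "y = a \<frown> b" and b: "X \<frown> X \<frown> X \<frown> butlast X \<frown> w = fib_word b"
    by (rule fib_word_split_L0) (rule hd)
  obtain Y b1 where Y: "b = Y \<frown> b1" "X = fib_list Y"
    and b1: "X \<frown> X \<frown> butlast X \<frown> w = fib_word b1"
    by (rule fib_word_split_L0[OF b[symmetric] hd])
  obtain b2 where b2: "b1 = Y \<frown> b2" "X \<frown> butlast X \<frown> w = fib_word b2"
    by (rule fib_word_split_fib_list[OF b1[symmetric, unfolded Y(2)] hd[unfolded Y(2)]])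
      (auto simp: Y(2))
  obtain Z c where Z: "Y = Z @ [c]"
    using X Y(2) by (cases Y rule: rev_cases) auto
  \<comment> \<open>If \<open>Y\<close> consisted of 1s only, two adjacent copies would contain 11.
    A 0 in \<open>Y\<close> makes its image strictly longer, which gives the smaller period and
    keeps \<open>butlast X\<close> nonempty.\<close>
  have "L0 \<in> set Y"
  proof (rule ccontr)
    assume no0: "L0 \<notin> set Y"
    obtain d Z' where Z': "Y = d # Z'" using Z by (metis append_is_Nil_conv list.exhaust not_Cons_self2)
    have "c = L1" using no0 Z by (cases c) auto
    moreover have "d = L1" using no0 Z' by (cases d) auto
    moreover have "y = a \<frown> (Z @ [c]) \<frown> (d # Z') \<frown> b2"
      unfolding Z[symmetric] Z'[symmetric] using y Y b2 by simp
    ultimately show False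
      using no11 factorI[of y "a @ Z" "[L1, L1]" "Z' \<frown> b2"] by simp
  qed
  then have less: "length Y < length X" using length_less_fib_list Y(2) by blast
  then have "butlast X \<noteq> []" using Z by (cases X rule: rev_cases) auto
  then have "(butlast X \<frown> w) 0 = L0" using X by (cases X) auto
  then obtain b3 where b3: "b2 = Y \<frown> b3" "butlast X \<frown> w = fib_word b3"
    by (rule fib_word_split_fib_list[OF b2(2)[symmetric, unfolded Y(2)], folded Y(2)])
      (auto simp: Y(2))
  have "\<exists>b4. b3 = Z \<frown> b4"
  proof (cases c)
    case L0
    then have "butlast X = fib_list Z @ [L0]" using Y(2) Z by (simp add: butlast_append)
    then have "fib_word b3 = fib_list Z \<frown> L0 ## w" using b3(2) by simp
    then show ?thesis by (rule fib_word_split_fib_list) auto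
  next
    case c: L1
    then have "butlast X = fib_list Z" using Y(2) Z by (simp add: butlast_append)
    then have eq: "fib_word b3 = fib_list Z \<frown> w" using b3(2) by simp
    show ?thesis
    proof (cases "w 0")
      case L0
      then show ?thesis using fib_word_split_fib_list[OF eq] by blast
    next
      \<comment> \<open>A following 1 puts the cut inside a block, so phi(Z) ends in a block 0. Then
        \<open>Z\<close> ends in 1 and \<open>Y\<close> in 11.\<close>
      case L1
      then obtain Z' where "fib_list Z = fib_list Z' @ [L0]"
        using fib_word_split[OF eq] by auto
      then have "Z = Z' @ [L1]"
        using fib_list_inject[of Z "Z' @ [L1]"] by simp
      then have "factor [L1, L1] y"
        using y Y Z c by (intro factorI[of _ "a @ Z'" _ b1]) auto
      then show ?thesis using no11 by simp
    qed
  qed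
  then obtain b4 where "b3 = Z \<frown> b4" ..
  then have "y = a \<frown> (Y @ Y @ Y @ butlast Y) \<frown> b4"
    using y Y b2 b3 Z by simp
  then have "has_4m_power (length Y) y" using Z by (intro has_4m_powerI) auto
  then show ?thesis using less X(1) by auto
qed

lemma fib_word_L0: obtains u where "fib_word w = L0 ## u"
  by (metis build_first fib_word_0)

text \<open>The image of the truncated copy lacks at most one letter of the required truncation,
  namely the 0 that starts phi(0), and the image of whatever follows starts with 0.\<close>

lemma has_4m_power_fib_wordI:
  assumes "has_4m_power n y"
  shows "\<exists>m. has_4m_power m (fib_word y)"
proof -
  obtain v Y w where Y: "Y \<noteq> []" "y = v \<frown> (Y @ Y @ Y @ butlast Y) \<frown> w"
    using assms unfolding has_4m_power_def by blast
  obtain Z c where Z: "Y = Z @ [c]" using Y by (cases Y rule: rev_cases) auto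
  let ?X = "fib_list Y"
  obtain r u where r: "butlast ?X = fib_list Z @ r" "fib_word w = r \<frown> u"
  proof (cases c)
    case L0
    then show ?thesis using that[of "[L0]"] fib_word_L0[of w] by (auto simp: Z butlast_append)
  next
    case L1
    then show ?thesis using that[of "[]"] by (simp add: Z butlast_append)
  qed
  have "y = v \<frown> (Y @ Y @ Y @ Z) \<frown> w" using Y Z by simp
  then have "fib_word y = fib_list v \<frown> (?X @ ?X @ ?X @ fib_list Z) \<frown> r \<frown> u"
    by (simp only: fib_word_conc map_append concat_append r(2))
  then have "fib_word y = fib_list v \<frown> (?X @ ?X @ ?X @ butlast ?X) \<frown> u"
    unfolding r(1) by simp
  then have "has_4m_power (length ?X) (fib_word y)" by (rule has_4m_powerI) (simp add: Z)
  then show ?thesis ..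
qed

(* If 0 z starts with Y Y Y Y-, then its image starts with a fourth power of the image of Y
   (here the absence of 000 enters), and dropping the first letter leaves the power of a
   conjugate. *)
lemma has_4m_power_L1_fib_word:
  assumes "has_4m_power n (L0 ## z)" "\<not> factor [L1, L1] (L0 ## z)"
    "\<not> factor [L0, L0, L0] (L0 ## z)"
  shows "\<exists>m. has_4m_power m (L1 ## fib_word z)"
proof -
  obtain v Y w where Y: "Y \<noteq> []" "L0 ## z = v \<frown> (Y @ Y @ Y @ butlast Y) \<frown> w"
    using assms(1) unfolding has_4m_power_def by blast
  show ?thesis
  proof (cases v)
    case (Cons d v')
    then have "z = v' \<frown> (Y @ Y @ Y @ butlast Y) \<frown> w" using Y by simp
    then have "has_4m_power (length Y) z" using has_4m_powerI Y(1) by blast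
    then show ?thesis using has_4m_power_fib_wordI has_4m_power_build by blast
  next
    case Nil
    obtain d Y' where "Y = d # Y'" using Y by (cases Y) auto
    then have d: "Y = L0 # Y'" using Y Nil by simp
    have "Y' \<noteq> []"
    proof
      assume "Y' = []"
      then have "L0 ## z = [] \<frown> [L0, L0, L0] \<frown> w" using Y Nil d by simp
      then show False using assms(3) factorI by blast
    qed
    then obtain Z c where Z: "Y' = Z @ [c]" by (cases Y' rule: rev_cases) auto
    have z: "z = (Z @ c # L0 # Z @ c # L0 # Z @ c # L0 # Z) \<frown> w"
      using Y Nil d Z by (simp add: butlast_append)
    show ?thesis
    proof (cases c)
      case L1
      \<comment> \<open>This is phi(0 Z 1) = 01 phi(Z) 0 with its leading 0 moved to the end; the
        last 0 needed comes from phi(w).\<close>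
      let ?X = "L1 # fib_list Z @ [L0, L0]"
      obtain u where "fib_word w = L0 ## u" by (rule fib_word_L0)
      then have "L1 ## fib_word z = [] \<frown> (?X @ ?X @ ?X @ butlast ?X) \<frown> u"
        by (simp add: z L1 butlast_append)
      then show ?thesis using has_4m_powerI by blast
    next
      case c: L0
      \<comment> \<open>Here the truncated conjugate ends in 01, so phi(w) has to start with 01. If
        \<open>w\<close> started with 1, an empty \<open>Z\<close> or one ending in 0 would give
        000, and one ending in 1 would give 11.\<close>
      have "w 0 = L0"
      proof (rule ccontr)
        assume "w 0 \<noteq> L0"
        then obtain w' where w: "w = L1 ## w'" by (metis build_first letter.exhaust)
        show False
        proof (cases Z rule: rev_cases)
          case Nil
          then show False using assms(3) factorI[of "L0 ## z" "[]" "[L0, L0, L0]"]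
            by (simp add: z c)
        next
          case (snoc Z' d)
          show False
          proof (cases d)
            case L0
            then have "L0 ## z = (L0 # Z') \<frown> [L0, L0, L0] \<frown> (Z @ L0 # L0 # Z @ L0 # L0 # Z) \<frown> w"
              by (simp add: z c snoc)
            then show False using assms(3) factorI by blast
          next
            case L1
            have "L0 ## z = (L0 # Z @ c # L0 # Z @ c # L0 # Z @ c # L0 # Z') \<frown> [L1, L1] \<frown> w'"
              using w by (simp add: z c snoc L1)
            then show False using assms(2) factorI by blast
          qed
        qed
      qed
      then obtain w' where w: "w = L0 ## w'" by (metis build_first)
      let ?X = "L1 # fib_list Z @ [L0, L1, L0]"
      have "L1 ## fib_word ((Z @ c # L0 # Z @ c # L0 # Z @ c # L0 # Z) \<frown> L0 ## w')
         = [] \<frown> (?X @ ?X @ ?X @ butlast ?X) \<frown> fib_word w'"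
        by (simp add: c butlast_append)
      then show ?thesis using has_4m_powerI w z by (metis list.distinct(1))
    qed
  qed
qed

text \<open>The word starts with 10101001. A power at its very beginning thus has a period word
  starting with 101010, which ends in 0 because the next copy starts with 1. Two copies then contain
  0101010, a power of period 2 that avoids the leading 1, and ordinary descent applies to
  it.\<close>

lemma has_4m_power_L1_fib_word_L0D:
  assumes no11: "\<not> factor [L1, L1] (L0 ## z)" and z: "z = L0 ## L1 ## L0 ## z'"
    and "has_4m_power n (L1 ## fib_word (L0 ## z))"
  shows "\<exists>m<n. has_4m_power m (L0 ## z)"
proof -
  obtain v X w where X: "X \<noteq> []" "length X = n"
    and eq: "L1 ## fib_word (L0 ## z) = v \<frown> (X @ X @ X @ butlast X) \<frown> w"
    using assms(3) unfolding has_4m_power_def by blast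
  show ?thesis
  proof (cases v)
    case (Cons d v')
    then have "fib_word (L0 ## z) = v' \<frown> (X @ X @ X @ butlast X) \<frown> w" using eq by simp
    then have "has_4m_power n (fib_word (L0 ## z))" using has_4m_powerI X by blast
    then show ?thesis using has_4m_power_fib_wordD no11 by blast
  next
    case Nil
    then have eq: "L1 ## L0 ## L1 ## L0 ## L1 ## L0 ## L0 ## L1 ## fib_word z'
      = X \<frown> X \<frown> X \<frown> butlast X \<frown> w"
      using eq by (simp add: z)
    have "\<exists>X'. X = [L1, L0, L1, L0, L1, L0] @ X'"
      using eq X(1)
      by (cases X; cases "tl X"; cases "tl (tl X)"; cases "tl (tl (tl X))";
          cases "tl (tl (tl (tl X)))"; cases "tl (tl (tl (tl (tl X))))") auto
    then obtain X' where X': "X = [L1, L0, L1, L0, L1, L0] @ X'" ..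
    obtain X'' d where d: "X = L1 # X'' @ [d]" using X' by (cases X' rule: rev_cases) auto
    have "d = L0"
    proof (rule ccontr)
      assume "d \<noteq> L0"
      then have "d = L1" by (cases d) auto
      have "fib_word (L0 ## L0 ## z) = [L0] \<frown> X \<frown> X \<frown> X \<frown> butlast X \<frown> w"
        using eq by (simp add: z)
      also have "\<dots> = [L0] \<frown> (L1 # X'' @ [d]) \<frown> ([L1, L0, L1, L0, L1, L0] @ X') \<frown> X \<frown> butlast X \<frown> w"
        unfolding d[symmetric] X'[symmetric] ..
      also have "\<dots> = (L0 # L1 # X'') \<frown> [L1, L1] \<frown> ([L0, L1, L0, L1, L0] @ X') \<frown> X \<frown> butlast X \<frown> w"
        using \<open>d = L1\<close> by simp
      finally show False using no_11_fib_word factorI by blast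
    qed
    then have X'': "X = L1 # X'' @ [L0]" using d by simp
    have "L1 ## fib_word (L0 ## z) = (L1 # X'' @ [L0]) \<frown> ([L1, L0, L1, L0, L1, L0] @ X') \<frown> X \<frown> butlast X \<frown> w"
      unfolding X''[symmetric] X'[symmetric] using eq by (simp add: z)
    then have "fib_word (L0 ## z) = X'' \<frown> ([L0, L1] @ [L0, L1] @ [L0, L1] @ butlast [L0, L1]) \<frown> X' \<frown> X \<frown> butlast X \<frown> w"
      by simp
    then have "has_4m_power 2 (fib_word (L0 ## z))"
      using has_4m_powerI[of _ _ "[L0, L1]"] by (metis One_nat_def Suc_1 length_Cons list.distinct(1) list.size(3))
    then obtain m where "m < 2" "has_4m_power m (L0 ## z)"
      using has_4m_power_fib_wordD no11 by blast
    moreover have "2 < n" using X X' by auto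
    ultimately show ?thesis using less_trans by blast
  qed
qed

section \<open>The words generated from 010\<close>

abbreviation gen :: "oper word \<Rightarrow> letter word" where
  "gen f \<equiv> [L0, L1, L0] \<bullet>\<^sub>\<omega> f"

lemma fib_list_fibw: "fib_list (fibw n) = fibw (Suc n)"
  by (induction n rule: fibw.induct) auto

text \<open>The word 01 is F_1, which \<beta> inserts at the initial index 2, and it is also
  phi(0).\<close>

fun shift :: "oper \<Rightarrow> letter list" where
  "shift \<alpha> = []"
| "shift \<beta> = [L0, L1]"

lemma bounded_by_fib_Suc:
  assumes "n \<ge> 1" "bounded_by_fib n y"
  shows "bounded_by_fib (Suc n) y" "bounded_by_fib (Suc n) (y @ fibw (n - 1))"
  using assms(2) fibw_rec[OF assms(1)] count_fibw_L0[of n]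
  by (auto simp: bounded_by_fib_def parikh_def)

lemma act_append_fibw:
  assumes "bounded_by_fib n y"
  shows "act n \<gamma> (y @ fibw n) = y @ (case \<gamma> of \<alpha> \<Rightarrow> [] | \<beta> \<Rightarrow> fibw (n - 1)) @ fibw (Suc n)"
  using assms by (cases \<gamma>) (simp_all add: alpha_eq beta_eq)

text \<open>An extra operator in front raises the index of all later ones by one, as phi does to the
  Fibonacci words they insert. Both bounds are carried through the induction because the operators
  are specified only on words with a bounded part y.\<close>

lemma bullet_Cons_form:
  "\<exists>y. bounded_by_fib (length f + 2) y \<and> [L0, L1, L0] \<bullet> f = y @ fibw (length f + 2) \<and>
    bounded_by_fib (length f + 3) (shift \<gamma> @ fib_list y) \<and>
    [L0, L1, L0] \<bullet> (\<gamma> # f) = shift \<gamma> @ fib_list y @ fibw (length f + 3)"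
proof (induction f rule: rev_induct)
  case Nil
  have "[L0, L1, L0] \<bullet> [\<gamma>] = act 2 \<gamma> [L0, L1, L0]"
    using bullet_snoc[of _ "[]" \<gamma>] by (simp add: numeral_2_eq_2)
  also have "[L0, L1, L0] = [] @ fibw 2" by (simp add: numeral_2_eq_2)
  also have "act 2 \<gamma> \<dots> = shift \<gamma> @ fibw 3"
    by (subst act_append_fibw)
      (cases \<gamma>; simp add: bounded_by_fib_def parikh_def numeral_2_eq_2 numeral_3_eq_3)+
  finally show ?case
    by (intro exI[of _ "[]"]; cases \<gamma>)
      (simp_all add: bounded_by_fib_def parikh_def numeral_2_eq_2 numeral_3_eq_3)
next
  case (snoc \<delta> f)
  let ?n = "length f + 2"
  obtain y where y: "bounded_by_fib ?n y" "[L0, L1, L0] \<bullet> f = y @ fibw ?n"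
    "bounded_by_fib (?n + 1) (shift \<gamma> @ fib_list y)"
    "[L0, L1, L0] \<bullet> (\<gamma> # f) = shift \<gamma> @ fib_list y @ fibw (?n + 1)"
    using snoc by (auto simp: eval_nat_numeral)
  define r where "r = (case \<delta> of \<alpha> \<Rightarrow> [] | \<beta> \<Rightarrow> fibw (?n - 1))"
  have r: "fib_list r = (case \<delta> of \<alpha> \<Rightarrow> [] | \<beta> \<Rightarrow> fibw (?n + 1 - 1))"
    unfolding r_def by (cases \<delta>) (simp_all add: fib_list_fibw)
  have "[L0, L1, L0] \<bullet> (f @ [\<delta>]) = (y @ r) @ fibw (?n + 1)"
    using act_append_fibw[OF y(1), of \<delta>] y(2) by (simp add: r_def)
  moreover have "[L0, L1, L0] \<bullet> (\<gamma> # f @ [\<delta>]) = shift \<gamma> @ fib_list (y @ r) @ fibw (?n + 2)"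
    using act_append_fibw[OF y(3), of \<delta>] y(4) bullet_snoc[of _ "\<gamma> # f" \<delta>] r
    by simp
  moreover have "bounded_by_fib (?n + 1) (y @ r)"
    using bounded_by_fib_Suc[OF _ y(1)] by (cases \<delta>) (simp_all add: r_def)
  moreover have "bounded_by_fib (?n + 2) (shift \<gamma> @ fib_list (y @ r))"
    using bounded_by_fib_Suc[OF _ y(3)] r by (cases \<delta>) simp_all
  ultimately show ?case
    by (intro exI[of _ "y @ r"]) (simp add: eval_nat_numeral)
qed

lemma bullet_Cons:
  "[L0, L1, L0] \<bullet> (\<gamma> # f) = shift \<gamma> @ fib_list ([L0, L1, L0] \<bullet> f)"
  using bullet_Cons_form[of f \<gamma>] by (auto simp: fib_list_fibw eval_nat_numeral)

lemma word_limit_prefixes: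
  assumes "\<And>n. \<exists>s. x = u n \<frown> s" "\<And>n. n < length (u n)"
  shows "word_limit u x"
  unfolding word_limit_def
proof (intro allI eventually_sequentiallyI)
  fix i n :: nat
  assume "i \<le> n"
  then have "i < length (u n)" using assms(2)[of n] by simp
  then show "i < length (u n) \<and> u n ! i = x i"
    using assms(1)[of n] by auto
qed

lemma gen_eqI: "(\<And>n. \<exists>s. x = ([L0, L1, L0] \<bullet> prefix n f) \<frown> s) \<Longrightarrow> gen f = x"
  using word_limit_unique[OF word_limit_bullet_omega[OF has_form_010] word_limit_prefixes]
    length_bullet[OF has_form_010] by blast

lemma word_limit_prefix:
  assumes "word_limit u x" "\<And>m n. m \<le> n \<Longrightarrow> Sublist.prefix (u m) (u n)"
  shows "\<exists>s. x = u n \<frown> s"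
proof -
  have "u n ! i = x i" if "i < length (u n)" for i
  proof -
    have "\<forall>\<^sub>F m in sequentially. u n ! i = x i"
      using assms(1)[unfolded word_limit_def, rule_format, of i] eventually_ge_at_top[of n]
    proof eventually_elim
      case (elim m)
      then show ?case using assms(2)[of n m] that by (auto simp: Sublist.prefix_def nth_append)
    qed
    then show ?thesis by simp
  qed
  then have "prefix (length (u n)) x = u n"
    by (intro nth_equalityI) auto
  then show ?thesis using prefix_suffix by metis
qed

lemma gen_prefix: "\<exists>s. gen f = ([L0, L1, L0] \<bullet> prefix n f) \<frown> s"
  by (rule word_limit_prefix[OF word_limit_bullet_omega[OF has_form_010]])
    (rule bullet_prefix_mono[OF has_form_010])

text \<open>The finite recursion concerns a nonempty operator prefix, so it is used at n + 1;
  monotonicity then returns to n, including n = 0.\<close>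

lemma gen_build: "gen (\<gamma> ## f) = shift \<gamma> \<frown> fib_word (gen f)"
proof (rule gen_eqI)
  fix n
  obtain s where "gen f = ([L0, L1, L0] \<bullet> prefix n f) \<frown> s" using gen_prefix by blast
  then have s: "shift \<gamma> \<frown> fib_word (gen f) = ([L0, L1, L0] \<bullet> prefix (Suc n) (\<gamma> ## f)) \<frown> fib_word s"
    by (simp only: fib_word_conc prefix_Suc_build bullet_Cons conc_conc append_assoc)
  have "Sublist.prefix ([L0, L1, L0] \<bullet> prefix n (\<gamma> ## f)) ([L0, L1, L0] \<bullet> prefix (Suc n) (\<gamma> ## f))"
    by (rule bullet_prefix_step[OF has_form_010])
  then show "\<exists>s. shift \<gamma> \<frown> fib_word (gen f) = ([L0, L1, L0] \<bullet> prefix n (\<gamma> ## f)) \<frown> s"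
    unfolding s Sublist.prefix_def by (metis conc_conc)
qed

lemma gen_simps [simp]:
  "gen (\<alpha> ## f) = fib_word (gen f)"
  "gen (\<beta> ## f) = L0 ## L1 ## fib_word (gen f)"
  by (simp_all add: gen_build)

lemma gen_010: obtains s where "gen f = L0 ## L1 ## L0 ## s"
  using gen_prefix[of f 0] by auto

lemma factor_build_iff: "factor u (a ## x) \<longleftrightarrow> (\<exists>w. a ## x = u \<frown> w) \<or> factor u x"
proof
  assume "factor u (a ## x)"
  then obtain v w where vw: "a ## x = v \<frown> u \<frown> w" unfolding factor_def by blast
  show "(\<exists>w. a ## x = u \<frown> w) \<or> factor u x"
  proof (cases v)
    case Nil
    then show ?thesis using vw by auto
  next
    case (Cons b v')
    then have "x = v' \<frown> u \<frown> w" using vw by simp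
    then show ?thesis using factorI by blast
  qed
next
  assume "(\<exists>w. a ## x = u \<frown> w) \<or> factor u x"
  then show "factor u (a ## x)"
    using factor_build factorI[of "a ## x" "[]" u] by (auto simp del: conc_conc)
qed

text \<open>The preimage is A(g) or 0 A(g), which has no 11 because A(g) is itself an image. Its
  first letter 0 shows that A(f) starts with 01, which settles the left edge of the extensions
  below.\<close>

lemma gen_fib_word: obtains y where "gen f = fib_word (L0 ## y)" "\<not> factor [L1, L1] (L0 ## y)"
proof -
  have gen: "\<exists>y. gen f = fib_word y \<and> (y = gen g \<or> y = L0 ## gen g)" if "f = \<gamma> ## g" for \<gamma> f g
    using that by (cases \<gamma>) (auto intro: fib_word_build(1)[symmetric])
  have no: "\<not> factor [L1, L1] (gen g)" for g
    using gen no_11_fib_word by (metis word_cases)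
  moreover have "\<not> factor [L1, L1] (L0 ## gen g)" for g
    using no[of g] by (simp add: factor_build_iff)
  ultimately obtain y where y: "gen f = fib_word y" "\<not> factor [L1, L1] y"
    using gen by (metis word_cases)
  obtain a y' where y': "y = a ## y'" by (rule word_cases)
  obtain s where s: "gen f = L0 ## L1 ## L0 ## s" by (rule gen_010)
  have "a = L0"
  proof (rule ccontr)
    assume "a \<noteq> L0"
    then have "a = L1" by (cases a) auto
    then have "fib_word y' = L1 ## L0 ## s" using y(1) s by (simp add: y')
    then have "fib_word y' 0 = L1" by (simp only: build.simps)
    then show False by simp
  qed
  then show ?thesis using y y' that by simp
qed

lemma gen_no_11:
  "\<not> factor [L1, L1] (gen f)"
  "\<not> factor [L1, L1] (L0 ## gen f)"
  "\<not> factor [L1, L1] (L1 ## gen f)"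
  "\<not> factor [L1, L1] (L1 ## L0 ## gen f)"
  "\<not> factor [L1, L1] (L0 ## L1 ## gen f)"
  "\<not> factor [L1, L1] (L0 ## L1 ## L0 ## gen f)"
proof -
  obtain y where y: "gen f = fib_word (L0 ## y)" by (rule gen_fib_word)
  show "\<not> factor [L1, L1] (gen f)" unfolding y by (rule no_11_fib_word)
  then show "\<not> factor [L1, L1] (L0 ## gen f)"
    "\<not> factor [L1, L1] (L1 ## gen f)"
    "\<not> factor [L1, L1] (L1 ## L0 ## gen f)"
    "\<not> factor [L1, L1] (L0 ## L1 ## gen f)"
    "\<not> factor [L1, L1] (L0 ## L1 ## L0 ## gen f)"
    by (auto simp: factor_build_iff y)
qed

lemma gen_no_000:
  "\<not> factor [L0, L0, L0] (L0 ## gen f)"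
  "\<not> factor [L0, L0, L0] (L0 ## L1 ## gen f)"
  "\<not> factor [L0, L0, L0] (L0 ## L1 ## L0 ## gen f)"
proof -
  obtain y where y: "gen f = fib_word (L0 ## y)" "\<not> factor [L1, L1] (L0 ## y)"
    by (rule gen_fib_word)
  then have "\<not> factor [L0, L0, L0] (gen f)" by (simp only: no_000_fib_word not_False_eq_True)
  then show "\<not> factor [L0, L0, L0] (L0 ## gen f)"
    "\<not> factor [L0, L0, L0] (L0 ## L1 ## gen f)"
    "\<not> factor [L0, L0, L0] (L0 ## L1 ## L0 ## gen f)"
    by (auto simp: factor_build_iff y(1))
qed

section \<open>Powers in left extensions\<close>

(* Operator words f for which 0 gen f is not faux-bonacci. *)
inductive rejected :: "oper word \<Rightarrow> bool" where
  alpha: "rejected f \<Longrightarrow> rejected (\<alpha> ## \<gamma> ## f)"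
| loop: "rejected f \<Longrightarrow> rejected (\<beta> ## replicate k \<beta> \<frown> \<alpha> ## \<alpha> ## f)"
| exit: "rejected (\<beta> ## replicate k \<beta> \<frown> \<alpha> ## \<beta> ## f)"

abbreviation bad :: "letter word \<Rightarrow> bool" where
  "bad x \<equiv> \<exists>n. has_4m_power n x"

lemma bad_build: "bad x \<Longrightarrow> bad (a ## x)"
  using has_4m_power_build by blast

lemma bad_fib_word: "bad y \<Longrightarrow> bad (fib_word y)"
  using has_4m_power_fib_wordI by blast

lemma bad_L1_fib_word:
  "bad (L0 ## z) \<Longrightarrow> \<not> factor [L1, L1] (L0 ## z) \<Longrightarrow> \<not> factor [L0, L0, L0] (L0 ## z)
    \<Longrightarrow> bad (L1 ## fib_word z)"
  using has_4m_power_L1_fib_word by blast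

text \<open>1 A(\<alpha> f) is phi(0 A(f)) without its first 0, and 1 A(\<beta> f) is phi(0 A(f))
  with a 1 in front.\<close>

lemma bad_L1_gen:
  assumes "bad (L0 ## gen f)"
  shows "bad (L1 ## gen (\<gamma> ## f))"
proof (cases \<gamma>)
  case \<alpha>
  then show ?thesis using bad_L1_fib_word[OF assms gen_no_11(2) gen_no_000(1)] by simp
next
  case \<beta>
  then show ?thesis using bad_build[OF bad_fib_word[OF assms]] by simp
qed

text \<open>1 0 A(\<beta> g) = 1 phi(1 0 A(g)), so the extension by 10 is a state that \<beta> maps
  to itself.\<close>

lemma bad_L1_L0_gen_replicate:
  "bad (L1 ## L0 ## gen f) \<Longrightarrow> bad (L1 ## L0 ## gen (replicate k \<beta> \<frown> f))"
proof (induction k)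
  case (Suc k)
  let ?g = "gen (replicate k \<beta> \<frown> f)"
  have "bad (L0 ## L1 ## L0 ## ?g)" using Suc bad_build by blast
  then have "bad (L1 ## fib_word (L1 ## L0 ## ?g))"
    using bad_L1_fib_word gen_no_11(6) gen_no_000(3) by blast
  then show ?case by simp
qed simp

text \<open>The chain is 1 0 A(\<alpha> f) = 1 phi(1 A(f)), then the run of \<beta>, then 0
  A(\<beta> g) = phi(1 0 A(g)). The operator after \<alpha> is still open, so \<open>loop\<close>
  and \<open>exit\<close> share this part.\<close>

lemma bad_L0_gen_loop:
  assumes "bad (L0 ## L1 ## gen f)"
  shows "bad (L0 ## gen (\<beta> ## replicate k \<beta> \<frown> \<alpha> ## f))"
proof -
  have "bad (L1 ## fib_word (L1 ## gen f))"
    using bad_L1_fib_word[OF assms gen_no_11(5) gen_no_000(2)] .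
  then have "bad (L1 ## L0 ## gen (\<alpha> ## f))" by simp
  from bad_fib_word[OF bad_L1_L0_gen_replicate[OF this]] show ?thesis by simp
qed

lemma bad_if_rejected: "rejected f \<Longrightarrow> bad (L0 ## gen f)"
proof (induction rule: rejected.induct)
  case (alpha f \<gamma>)
  \<comment> \<open>0 A(\<alpha> \<gamma> f) is phi(1 A(\<gamma> f)).\<close>
  from bad_fib_word[OF bad_L1_gen[OF this(2), of \<gamma>]]
  have "bad (L0 ## fib_word (gen (\<gamma> ## f)))" by (simp del: gen_simps)
  then show ?case by (simp only: gen_simps)
next
  case (loop f k)
  \<comment> \<open>0 1 A(\<alpha> f) is phi(0 A(f)).\<close>
  then have "bad (L0 ## L1 ## gen (\<alpha> ## f))" using bad_fib_word by fastforce
  then show ?case by (rule bad_L0_gen_loop)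
next
  case (exit k f)
  obtain s where "gen f = L0 ## L1 ## L0 ## s" by (rule gen_010)
  then have "L0 ## L1 ## gen (\<beta> ## f)
    = [] \<frown> ([L0, L1] @ [L0, L1] @ [L0, L1] @ butlast [L0, L1]) \<frown> L0 ## L1 ## fib_word s"
    by simp
  then have "bad (L0 ## L1 ## gen (\<beta> ## f))" using has_4m_powerI by blast
  then show ?case by (rule bad_L0_gen_loop)
qed

lemma rejected_beta:
  assumes "rejected (\<beta> ## f)"
  shows "rejected (\<beta> ## \<beta> ## f)"
  using assms
proof (cases rule: rejected.cases)
  case (loop g k)
  then show ?thesis using rejected.loop[of g "Suc k"] by simp
next
  case (exit k g)
  then show ?thesis using rejected.exit[of "Suc k" g] by simp
qed simp

(* The second part tracks 010 gen f, because its preimages keep that shape along a run of betas. *)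
lemma rejected_if_has_4m_power:
  "(has_4m_power n (L0 ## gen f) \<longrightarrow> rejected f) \<and>
   (has_4m_power n (L0 ## L1 ## L0 ## gen f) \<longrightarrow> rejected (\<beta> ## f))"
proof (induction n arbitrary: f rule: less_induct)
  case (less n)
  note D = has_4m_power_fib_wordD
  have IH: "has_4m_power m (L0 ## gen g) \<Longrightarrow> rejected g"
    "has_4m_power m (L0 ## L1 ## L0 ## gen g) \<Longrightarrow> rejected (\<beta> ## g)" if "m < n" for m g
    using less that by blast+
  obtain \<gamma> g where f: "f = \<gamma> ## g" by (rule word_cases)
  show ?case
  proof (intro conjI impI)
    assume n: "has_4m_power n (L0 ## gen f)"
    show "rejected f"
    proof (cases \<gamma>)
      case \<alpha>
      then have "has_4m_power n (fib_word (L1 ## gen g))" using n f by simp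
      from D[OF gen_no_11(3) this] obtain m where m: "m < n" "has_4m_power m (L1 ## gen g)"
        by blast
      obtain \<delta> h where g: "g = \<delta> ## h" by (rule word_cases)
      have "\<exists>k<m. has_4m_power k (L0 ## gen h)"
      proof (cases \<delta>)
        case \<alpha>
        \<comment> \<open>A 0 in front completes the half block without changing the period: 0 1
          A(\<alpha> h) = phi(0 A(h)).\<close>
        then have "has_4m_power m (fib_word (L0 ## gen h))"
          using has_4m_power_build[OF m(2), of L0] g by simp
        then show ?thesis by (rule D[OF gen_no_11(2)])
      next
        case \<beta>
        obtain s where "gen h = L0 ## L1 ## L0 ## s" by (rule gen_010)
        with gen_no_11(2) show ?thesis
          by (rule has_4m_power_L1_fib_word_L0D) (use m g \<beta> in simp)
      qed
      then show ?thesis using IH(1) m(1) f g \<alpha> rejected.alpha less_trans by metis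
    next
      case \<beta>
      then have "has_4m_power n (fib_word (L1 ## L0 ## gen g))" using n f by simp
      \<comment> \<open>Descent leads to 1 0 A(g); a 0 in front gives the shape of the second
        part.\<close>
      from D[OF gen_no_11(4) this] show ?thesis
        using IH(2) has_4m_power_build f \<beta> by blast
    qed
  next
    assume n: "has_4m_power n (L0 ## L1 ## L0 ## gen f)"
    show "rejected (\<beta> ## f)"
    proof (cases \<gamma>)
      case \<alpha>
      then have "has_4m_power n (fib_word (L0 ## L1 ## gen g))" using n f by simp
      from D[OF gen_no_11(5) this] obtain m where m: "m < n" "has_4m_power m (L0 ## L1 ## gen g)"
        by blast
      obtain \<delta> h where g: "g = \<delta> ## h" by (rule word_cases)
      show ?thesis
      proof (cases \<delta>)
        case \<alpha>
        then have "has_4m_power m (fib_word (L0 ## gen h))" using m g by simp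
        from D[OF gen_no_11(2) this] have "rejected h" using IH(1) m(1) less_trans by blast
        then show ?thesis using rejected.loop[of h 0] f g \<alpha> \<open>\<gamma> = \<alpha>\<close> by simp
      next
        case \<beta>
        then show ?thesis using rejected.exit[of 0 h] f g \<open>\<gamma> = \<alpha>\<close> by simp
      qed
    next
      case \<beta>
      then have "has_4m_power n (fib_word (L0 ## L1 ## L0 ## gen g))" using n f by simp
      from D[OF gen_no_11(6) this] show ?thesis
        using IH(2) rejected_beta f \<beta> by blast
    qed
  qed
qed

text \<open>A(\<gamma> f) has phi(A(f)) as a suffix, so a power survives every further operator in
  front. This is why a word of F may be matched anywhere in the operator word.\<close>

lemma bad_gen_conc: "bad (gen f) \<Longrightarrow> bad (gen (u \<frown> f))"
proof (induction u)
  case (Cons \<gamma> u)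
  then have "bad (fib_word (gen (u \<frown> f)))" using bad_fib_word by blast
  then show ?case using bad_build by (cases \<gamma>) simp_all
qed simp

text \<open>Each leading \<alpha> lowers the period, so a \<beta> must come, and it uncovers 0 A(g).
  This is the origin of the initial run of \<alpha> and the \<beta> in F; the forbidden factor even
  appears at the start of \<open>f\<close>.\<close>

lemma rejected_if_bad_gen:
  "has_4m_power n (gen f) \<Longrightarrow> \<exists>k g. f = replicate k \<alpha> \<frown> \<beta> ## g \<and> rejected g"
proof (induction n arbitrary: f rule: less_induct)
  case (less n)
  obtain \<gamma> g where f: "f = \<gamma> ## g" by (rule word_cases)
  show ?case
  proof (cases \<gamma>)
    case \<alpha>
    then have "has_4m_power n (fib_word (gen g))" using less f by simp
    from has_4m_power_fib_wordD[OF gen_no_11(1) this]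
    obtain k h where "g = replicate k \<alpha> \<frown> \<beta> ## h" "rejected h" using less by blast
    then show ?thesis using f \<alpha> by (intro exI[of _ "Suc k"] exI[of _ h]) simp
  next
    case \<beta>
    then have "has_4m_power n (fib_word (L0 ## gen g))" using less f by simp
    from has_4m_power_fib_wordD[OF gen_no_11(2) this] have "rejected g"
      using rejected_if_has_4m_power by blast
    then show ?thesis using f \<beta> by (intro exI[of _ 0] exI[of _ g]) simp
  qed
qed

section \<open>The forbidden language\<close>

lemma lstar_Nil: "[] \<in> lstar A"
  unfolding lstar_def by (rule image_eqI[of _ _ "[]"]) auto

lemma lstar_append: "u \<in> A \<Longrightarrow> v \<in> lstar A \<Longrightarrow> u @ v \<in> lstar A"
  unfolding lstar_def by (auto intro!: image_eqI[of _ _ "u # us" for us])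

lemma lstar_induct [consumes 1, case_names Nil append]:
  assumes "w \<in> lstar A" "P []" "\<And>u v. u \<in> A \<Longrightarrow> v \<in> lstar A \<Longrightarrow> P v \<Longrightarrow> P (u @ v)"
  shows "P w"
proof -
  obtain us where "us \<in> lists A" "w = concat us" using assms(1) unfolding lstar_def by auto
  then show ?thesis
  proof (induction us arbitrary: w)
    case (Cons u us)
    then show ?case using assms(3) unfolding lstar_def by auto
  qed (use assms(2) in auto)
qed

lemma lstar_singleton: "lstar {[a]} = range (\<lambda>k. replicate k a)"
proof (intro equalityI subsetI)
  fix w
  assume "w \<in> lstar {[a]}"
  then show "w \<in> range (\<lambda>k. replicate k a)"
  proof (induction rule: lstar_induct)
    case (append u v)
    then obtain k where "v = replicate k a" by auto
    then show ?case using append by (intro image_eqI[of _ _ "Suc k"]) auto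
  qed (auto intro: image_eqI[of _ _ 0])
next
  fix w
  assume "w \<in> range (\<lambda>k. replicate k a)"
  then obtain k where "w = replicate k a" by auto
  moreover have "replicate k a \<in> lstar {[a]}"
  proof (induction k)
    case (Suc k)
    then show ?case using lstar_append[of "[a]"] by simp
  qed (simp add: lstar_Nil)
  ultimately show "w \<in> lstar {[a]}" by simp
qed

text \<open>The starred part of F: its words are the cycles of the automaton at the state 0
  A(f).\<close>

definition loop_lang :: "oper list set" where
  "loop_lang = {[\<alpha>, \<alpha>]} \<union> {[\<alpha>, \<beta>]} \<union> {[\<beta>, \<alpha>, \<alpha>]} \<union> {[\<beta>, \<beta>]} \<cdot> lstar {[\<beta>]} \<cdot> {[\<alpha>, \<alpha>]}"

definition exit_lang :: "oper list set" where
  "exit_lang = {[\<beta>, \<alpha>, \<beta>]} \<union> {[\<beta>, \<beta>]} \<cdot> lstar {[\<beta>]} \<cdot> {[\<alpha>, \<beta>]}"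

text \<open>F separates a single \<beta> from a run of at least two; one run length covers both, as
  in the rules of \<open>rejected\<close>.\<close>

lemma beta_run_iff:
  "u \<in> {\<beta> # v} \<union> {[\<beta>, \<beta>]} \<cdot> lstar {[\<beta>]} \<cdot> {v} \<longleftrightarrow> (\<exists>k. u = \<beta> # replicate k \<beta> @ v)"
proof
  assume "u \<in> {\<beta> # v} \<union> {[\<beta>, \<beta>]} \<cdot> lstar {[\<beta>]} \<cdot> {v}"
  then consider "u = \<beta> # v" | k where "u = \<beta> # \<beta> # replicate k \<beta> @ v"
    unfolding lconc_def lstar_singleton by auto
  then show "\<exists>k. u = \<beta> # replicate k \<beta> @ v"
    by cases (auto intro: exI[of _ 0] exI[of _ "Suc k" for k])
next
  assume "\<exists>k. u = \<beta> # replicate k \<beta> @ v"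
  then obtain k where "u = \<beta> # replicate k \<beta> @ v" ..
  then show "u \<in> {\<beta> # v} \<union> {[\<beta>, \<beta>]} \<cdot> lstar {[\<beta>]} \<cdot> {v}"
    unfolding lconc_def lstar_singleton by (cases k) auto
qed

lemma exit_lang_iff: "u \<in> exit_lang \<longleftrightarrow> (\<exists>k. u = \<beta> # replicate k \<beta> @ [\<alpha>, \<beta>])"
  unfolding exit_lang_def by (rule beta_run_iff)

lemma loop_lang_iff:
  "u \<in> loop_lang \<longleftrightarrow> (\<exists>\<gamma>. u = [\<alpha>, \<gamma>]) \<or> (\<exists>k. u = \<beta> # replicate k \<beta> @ [\<alpha>, \<alpha>])"
proof -
  have "(\<exists>\<gamma>. u = [\<alpha>, \<gamma>]) \<longleftrightarrow> u = [\<alpha>, \<alpha>] \<or> u = [\<alpha>, \<beta>]" by (metis oper.exhaust)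
  then show ?thesis unfolding loop_lang_def using beta_run_iff[of u "[\<alpha>, \<alpha>]"] by blast
qed

lemma mem_lconc: "w \<in> A \<cdot> B \<longleftrightarrow> (\<exists>u\<in>A. \<exists>v\<in>B. w = u @ v)"
  unfolding lconc_def by blast

lemma append_in_lconc: "u \<in> A \<Longrightarrow> v \<in> B \<Longrightarrow> u @ v \<in> A \<cdot> B"
  unfolding lconc_def by blast

lemma lstar_lconc_append: "v \<in> A \<Longrightarrow> u \<in> lstar A \<cdot> B \<Longrightarrow> v @ u \<in> lstar A \<cdot> B"
  unfolding mem_lconc using lstar_append by (metis append_assoc)

lemma lstar_lconc_conc:
  "v \<in> A \<Longrightarrow> \<exists>u \<in> lstar A \<cdot> B. \<exists>h. f = u \<frown> h \<Longrightarrow> \<exists>u \<in> lstar A \<cdot> B. \<exists>h. v \<frown> f = u \<frown> h"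
  using lstar_lconc_append by (metis conc_conc)

text \<open>The rules \<open>alpha\<close> and \<open>loop\<close> each prepend one word of
  \<open>loop_lang\<close>, and \<open>exit\<close> supplies the word of
  \<open>exit_lang\<close>.\<close>

lemma rejected_iff: "rejected f \<longleftrightarrow> (\<exists>u \<in> lstar loop_lang \<cdot> exit_lang. \<exists>h. f = u \<frown> h)"
proof
  assume "rejected f"
  then show "\<exists>u \<in> lstar loop_lang \<cdot> exit_lang. \<exists>h. f = u \<frown> h"
  proof induction
    case (alpha f \<gamma>)
    have "[\<alpha>, \<gamma>] \<in> loop_lang" unfolding loop_lang_iff by blast
    from lstar_lconc_conc[OF this alpha.IH] show ?case by simp
  next
    case (loop f k)
    have "\<beta> # replicate k \<beta> @ [\<alpha>, \<alpha>] \<in> loop_lang" unfolding loop_lang_iff by blast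
    from lstar_lconc_conc[OF this loop.IH] show ?case by simp
  next
    case (exit k f)
    let ?u = "\<beta> # replicate k \<beta> @ [\<alpha>, \<beta>]"
    have "?u \<in> exit_lang" unfolding exit_lang_iff by blast
    then have "[] @ ?u \<in> lstar loop_lang \<cdot> exit_lang"
      by (rule append_in_lconc[OF lstar_Nil])
    moreover have "\<beta> ## replicate k \<beta> \<frown> \<alpha> ## \<beta> ## f = ([] @ ?u) \<frown> f" by simp
    ultimately show ?case by blast
  qed
next
  assume "\<exists>u \<in> lstar loop_lang \<cdot> exit_lang. \<exists>h. f = u \<frown> h"
  then obtain u h where u: "u \<in> lstar loop_lang \<cdot> exit_lang" and fu: "f = u \<frown> h" by (elim bexE exE)
  from u obtain a b where a: "a \<in> lstar loop_lang" and "b \<in> exit_lang" and "u = a @ b"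
    unfolding mem_lconc by (elim bexE)
  then have f: "f = a \<frown> b \<frown> h" using fu by simp
  have "\<exists>k. b = \<beta> # replicate k \<beta> @ [\<alpha>, \<beta>]" using \<open>b \<in> exit_lang\<close> unfolding exit_lang_iff .
  then obtain k where "b = \<beta> # replicate k \<beta> @ [\<alpha>, \<beta>]" ..
  then have b: "rejected (b \<frown> h)" using rejected.exit by simp
  from a have "rejected (a \<frown> b \<frown> h)"
  proof (induction rule: lstar_induct)
    case (append u v)
    from append(1) consider \<gamma> where "u = [\<alpha>, \<gamma>]" | k where "u = \<beta> # replicate k \<beta> @ [\<alpha>, \<alpha>]"
      unfolding loop_lang_iff by blast
    then have "rejected (u \<frown> v \<frown> b \<frown> h)"
      using append(3) rejected.alpha rejected.loop by cases simp_all
    then show ?case by simp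
  qed (simp add: b)
  then show "rejected f" using f by simp
qed

lemma lstar_singleton_lconc_iff:
  "w \<in> lstar {[a]} \<cdot> {[b]} \<cdot> A \<longleftrightarrow> (\<exists>k. \<exists>v\<in>A. w = replicate k a @ b # v)"
  by (fastforce simp: lstar_singleton mem_lconc)

lemma F_lang_iff:
  "w \<in> F_lang \<longleftrightarrow> (\<exists>k. \<exists>v \<in> lstar loop_lang \<cdot> exit_lang. w = replicate k \<alpha> @ \<beta> # v)"
  unfolding F_lang_def loop_lang_def[symmetric] exit_lang_def[symmetric]
  by (rule lstar_singleton_lconc_iff)

lemma F_lang_conc_iff:
  "(\<exists>u \<in> F_lang. \<exists>h. f = u \<frown> h) \<longleftrightarrow> (\<exists>k g. f = replicate k \<alpha> \<frown> \<beta> ## g \<and> rejected g)"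
proof
  assume "\<exists>u \<in> F_lang. \<exists>h. f = u \<frown> h"
  then obtain w h where "w \<in> F_lang" and fw: "f = w \<frown> h" by blast
  then obtain k v where v: "v \<in> lstar loop_lang \<cdot> exit_lang" and "w = replicate k \<alpha> @ \<beta> # v"
    unfolding F_lang_iff by (elim exE bexE)
  then have "f = replicate k \<alpha> \<frown> \<beta> ## v \<frown> h" using fw by simp
  moreover have "rejected (v \<frown> h)"
    unfolding rejected_iff by (rule bexI[OF _ v]) (rule exI, rule refl)
  ultimately show "\<exists>k g. f = replicate k \<alpha> \<frown> \<beta> ## g \<and> rejected g" by blast
next
  assume "\<exists>k g. f = replicate k \<alpha> \<frown> \<beta> ## g \<and> rejected g"
  then obtain k g where f: "f = replicate k \<alpha> \<frown> \<beta> ## g" and "rejected g" by blast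
  from \<open>rejected g\<close> obtain v h where v: "v \<in> lstar loop_lang \<cdot> exit_lang" and g: "g = v \<frown> h"
    unfolding rejected_iff by (elim bexE exE)
  have "replicate k \<alpha> @ \<beta> # v \<in> F_lang"
    unfolding F_lang_iff by (rule exI) (rule bexI[OF refl v])
  moreover have "f = (replicate k \<alpha> @ \<beta> # v) \<frown> h" using f g by simp
  ultimately show "\<exists>u \<in> F_lang. \<exists>h. f = u \<frown> h" by blast
qed

lemma faux_bonacci_gen_iff: "faux_bonacci (gen f) \<longleftrightarrow> f \<in> V"
proof -
  have "bad (gen f) \<longleftrightarrow> (\<exists>g u h. f = g \<frown> u \<frown> h \<and> u \<in> F_lang)"
  proof
    assume "bad (gen f)"
    then obtain u h where "u \<in> F_lang" "f = [] \<frown> u \<frown> h"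
      using rejected_if_bad_gen F_lang_conc_iff by (metis conc_empty)
    then show "\<exists>g u h. f = g \<frown> u \<frown> h \<and> u \<in> F_lang" by blast
  next
    assume "\<exists>g u h. f = g \<frown> u \<frown> h \<and> u \<in> F_lang"
    then obtain p k g where f: "f = p \<frown> replicate k \<alpha> \<frown> \<beta> ## g" and "rejected g"
      using F_lang_conc_iff by metis
    then have "bad (gen (\<beta> ## g))"
      using bad_fib_word[OF bad_if_rejected] by simp
    then show "bad (gen f)" unfolding f by (intro bad_gen_conc)
  qed
  moreover have "f \<in> V \<longleftrightarrow> \<not> (\<exists>g u h. f = g \<frown> u \<frown> h \<and> u \<in> F_lang)"
    unfolding V_def by blast
  ultimately show ?thesis using gen_no_11(1) faux_bonacci_iff by blast
qed

section \<open>Factorizing faux-bonacci words\<close>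

lemma prefix_010_iff: "prefix 3 x = [L0, L1, L0] \<longleftrightarrow> (\<exists>s. x = L0 ## L1 ## L0 ## s)"
proof
  assume "prefix 3 x = [L0, L1, L0]"
  then have "x = [L0, L1, L0] \<frown> suffix 3 x" by (metis prefix_suffix)
  then show "\<exists>s. x = L0 ## L1 ## L0 ## s" by auto
qed (auto simp: prefix_Suc_build numeral_3_eq_3 simp del: subseq_to_Suc)

lemma faux_bonacci_buildD: "faux_bonacci (a ## x) \<Longrightarrow> faux_bonacci x"
  using faux_bonacci_iff factor_build bad_build by metis

lemma faux_bonacci_no_000:
  assumes "faux_bonacci x"
  shows "\<not> factor [L0, L0, L0] x"
  using assms has_4m_powerI[of x _ "[L0]"] unfolding factor_def faux_bonacci_iff by fastforce

text \<open>The image of 11 is 00, the next block adds a 0, and 000 is the 4^- power with X =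
  0.\<close>

lemma faux_bonacci_fib_wordD:
  assumes "faux_bonacci (fib_word y)"
  shows "faux_bonacci y"
proof -
  have "\<not> factor [L1, L1] y"
  proof
    assume "factor [L1, L1] y"
    then obtain v w where "y = v \<frown> [L1, L1] \<frown> w" unfolding factor_def by blast
    moreover obtain u where "fib_word w = L0 ## u" by (rule fib_word_L0)
    ultimately have "fib_word y = fib_list v \<frown> [L0, L0, L0] \<frown> u" by simp
    then show False using faux_bonacci_no_000[OF assms] factorI by blast
  qed
  then show ?thesis using assms bad_fib_word faux_bonacci_iff by blast
qed

text \<open>As x starts with 01, its preimage starts with 0, and the second letter of the preimage
  picks the operator: 1 gives \<alpha>, while 0 gives \<beta>, whose shift absorbs the first 0. The
  absence of 000 and 11 forces the rest of 010.\<close>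

lemma faux_bonacci_step:
  assumes "faux_bonacci x" "prefix 3 x = [L0, L1, L0]"
  shows "\<exists>\<gamma> y. x = shift \<gamma> \<frown> fib_word y \<and> faux_bonacci y \<and> prefix 3 y = [L0, L1, L0]"
proof -
  obtain s where s: "x = L0 ## L1 ## L0 ## s"
    using assms(2) prefix_010_iff by blast
  then obtain y where y: "x = fib_word y"
    using desubstitution[of x] assms(1) faux_bonacci_iff by auto
  have fb: "faux_bonacci y" using faux_bonacci_fib_wordD assms(1) y by simp
  have next_L0: "\<exists>u. t = L0 ## u" if "faux_bonacci (L1 ## t)" for t
  proof -
    obtain a u where t: "t = a ## u" by (rule word_cases)
    have "a = L0"
    proof (rule ccontr)
      assume "a \<noteq> L0"
      then have "L1 ## t = [] \<frown> [L1, L1] \<frown> u" using t by (cases a) auto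
      then show False using that factorI faux_bonacci_iff by blast
    qed
    then show ?thesis using t by blast
  qed
  obtain a b t where t: "y = a ## b ## t" by (metis word_cases)
  have "a = L0"
  proof (rule ccontr)
    assume "a \<noteq> L0"
    then have "fib_word (b ## t) = L1 ## L0 ## s" using s y t by (cases a) auto
    then have "fib_word (b ## t) 0 = L1" by (simp only: build.simps)
    then show False by simp
  qed
  show ?thesis
  proof (cases b)
    case L1
    then have "prefix 3 y = [L0, L1, L0]"
      using next_L0 faux_bonacci_buildD fb t \<open>a = L0\<close> prefix_010_iff by blast
    then show ?thesis using y fb by (intro exI[of _ \<alpha>] exI[of _ y]) simp
  next
    case b: L0
    obtain c u where u: "t = c ## u" by (rule word_cases)
    have "c = L1"
    proof (rule ccontr)
      assume "c \<noteq> L1"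
      then have "y = [] \<frown> [L0, L0, L0] \<frown> u" using t u b \<open>a = L0\<close> by (cases c) auto
      then show False using faux_bonacci_no_000[OF fb] factorI by blast
    qed
    then have "prefix 3 (b ## t) = [L0, L1, L0]"
      using next_L0 faux_bonacci_buildD fb t u b prefix_010_iff by blast
    moreover have "x = shift \<beta> \<frown> fib_word (b ## t)" using y t \<open>a = L0\<close> by simp
    ultimately show ?thesis using fb t faux_bonacci_buildD by blast
  qed
qed

lemma faux_bonacci_gen:
  assumes "faux_bonacci x" "prefix 3 x = [L0, L1, L0]"
  shows "\<exists>f. x = gen f"
proof -
  \<comment> \<open>The clause for n = 0 anchors the chosen sequence at \<open>x\<close>.\<close>
  let ?P = "\<lambda>n y. (faux_bonacci y \<and> prefix 3 y = [L0, L1, L0]) \<and> (n = 0 \<longrightarrow> y = x)"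
  let ?Q = "\<lambda>(n::nat) y y'. \<exists>\<gamma>. y = shift \<gamma> \<frown> fib_word y'"
  have "\<exists>y. \<forall>n. ?P n (y n) \<and> ?Q n (y n) (y (Suc n))"
    by (rule dependent_nat_choice) (use assms faux_bonacci_step in blast)+
  then obtain y where y: "y 0 = x" "\<And>n. prefix 3 (y n) = [L0, L1, L0]"
    and "\<forall>n. ?Q n (y n) (y (Suc n))" by blast
  then obtain f where f: "\<And>n. y n = shift (f n) \<frown> fib_word (y (Suc n))" by metis
  \<comment> \<open>The claim is made for all k because peeling the first operator passes from
    \<open>y k\<close> to \<open>y (Suc k)\<close>.\<close>
  have "\<exists>s. y k = ([L0, L1, L0] \<bullet> prefix n (suffix k f)) \<frown> s" for k n
  proof (induction n arbitrary: k)
    case 0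
    show ?case using y(2)[of k] by (auto simp: prefix_010_iff)
  next
    case (Suc n)
    obtain s where "y (Suc k) = ([L0, L1, L0] \<bullet> prefix n (suffix (Suc k) f)) \<frown> s"
      using Suc by blast
    then have "y k = (shift (f k) @ fib_list ([L0, L1, L0] \<bullet> prefix n (suffix (Suc k) f))) \<frown> fib_word s"
      using f[of k] by (simp only: fib_word_conc conc_conc append_assoc)
    also have "suffix k f = f k ## suffix (Suc k) f"
      using build_first[of "suffix k f"] by simp
    then have "shift (f k) @ fib_list ([L0, L1, L0] \<bullet> prefix n (suffix (Suc k) f))
      = [L0, L1, L0] \<bullet> prefix (Suc n) (suffix k f)"
      by (simp only: bullet_Cons prefix_Suc_build)
    finally show ?case by blast
  qed
  from this[of 0] have "gen f = x" by (intro gen_eqI) (simp add: y(1))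
  then show ?thesis by blast
qed

theorem theorem7:
  fixes x :: "letter word"
  assumes "prefix 3 x = [L0, L1, L0]"
  shows "faux_bonacci x \<longleftrightarrow> (\<exists>f \<in> V. x = [L0, L1, L0] \<bullet>\<^sub>\<omega> f)"
  using faux_bonacci_gen[OF _ assms] faux_bonacci_gen_iff by blast

end
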